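(* Let $G$ be a graph and let $\overline{G}$ be its complement. The following hold. (a) If $\overline{G}$ is the disjoint union of two odd cycles of length at least $5$, then $I_c(G)$ is not normal. (b) If $\overline{G}$ is an odd cycle of length at least $5$, then $I_c(G)$ is normal.
   Context: Graphs are finite, with no multiple edges or loops. The vertices of $G$, $V(G)=\{t_1,\ldots,t_s\}$, are regarded as variables of the polynomial ring $S=K[t_1,\ldots,t_s]$ over a field $K$. The complement $\overline{G}$ has the same vertex set as $G$, and two distinct vertices are adjacent in $\overline{G}$ if and only if they are not adjacent in $G$. A vertex cover is a set of vertices meeting every edge; the ideal of covers $I_c(G)$ is the ideal of $S$ generated by all $\prod_{t_i\in C}t_i$ with $C$ an inclusion-minimal vertex cover of $G$. An ideal $J$ is normal if $J^n=\overline{J^n}$ for all $n\geq 1$, where $\overline{J^n}$ is the integral closure of $J^n$. *)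

theory Defs
  imports Complex_Main "HOL-Library.Poly_Mapping"
begin

text \<open>
  A commutative ring is a module over itself; its ideals are the submodules, and
  \<open>ideal.span B\<close> is the ideal generated by \<open>B\<close>.
\<close>

global_interpretation ideal: module "(*) :: 'a::comm_ring_1 \<Rightarrow> 'a \<Rightarrow> 'a"
  by unfold_locales (simp_all add: algebra_simps)

definition ideal_mult :: "'a::comm_ring_1 set \<Rightarrow> 'a set \<Rightarrow> 'a set" where
  "ideal_mult I J = ideal.span {a * b | a b. a \<in> I \<and> b \<in> J}"

primrec ideal_power :: "'a::comm_ring_1 set \<Rightarrow> nat \<Rightarrow> 'a set" where
  "ideal_power I 0 = UNIV"
| "ideal_power I (Suc n) = ideal_mult I (ideal_power I n)"

definition integral_closure :: "'a::comm_ring_1 set \<Rightarrow> 'a set" where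
  "integral_closure I =
    {x. \<exists>n\<ge>1. \<exists>a. (\<forall>i\<in>{1..n}. a i \<in> ideal_power I i) \<and>
          x ^ n + (\<Sum>i=1..n. a i * x ^ (n - i)) = 0}"

definition normal_ideal :: "'a::comm_ring_1 set \<Rightarrow> bool" where
  "normal_ideal I \<longleftrightarrow> (\<forall>n\<ge>1. ideal_power I n = integral_closure (ideal_power I n))"

text \<open>
  The vertex set is the whole finite type \<open>'v\<close>; a graph is given by its edge set.
\<close>

definition simple_graph :: "'v::finite set set \<Rightarrow> bool" where
  "simple_graph E \<longleftrightarrow> (\<forall>e\<in>E. card e = 2)"

definition complement_graph :: "'v::finite set set \<Rightarrow> 'v set set" where
  "complement_graph E = {{u, v} | u v. u \<noteq> v \<and> {u, v} \<notin> E}"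

text \<open>The graph with vertex set \<open>W\<close> and edge set \<open>F\<close> is a cycle of length \<open>n\<close>.\<close>

definition cycle_graph :: "nat \<Rightarrow> 'v set \<Rightarrow> 'v set set \<Rightarrow> bool" where
  "cycle_graph n W F \<longleftrightarrow> n \<ge> 3 \<and>
    (\<exists>f. bij_betw f {..<n} W \<and> F = (\<lambda>i. {f i, f (Suc i mod n)}) ` {..<n})"

definition vertex_cover :: "'v set set \<Rightarrow> 'v set \<Rightarrow> bool" where
  "vertex_cover E C \<longleftrightarrow> (\<forall>e\<in>E. e \<inter> C \<noteq> {})"

definition minimal_vertex_cover :: "'v set set \<Rightarrow> 'v set \<Rightarrow> bool" where
  "minimal_vertex_cover E C \<longleftrightarrow> vertex_cover E C \<and> (\<forall>D. D \<subset> C \<longrightarrow> \<not> vertex_cover E D)"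

text \<open>
  Exponent vectors are finitely supported functions \<open>'v \<Rightarrow>\<^sub>0 nat\<close>, and polynomials are
  finitely supported functions from exponent vectors to coefficients, with convolution
  as multiplication. For finite \<open>'v\<close> this is the polynomial ring with the vertices as
  variables.
\<close>

type_synonym ('v, 'k) mpoly = "('v \<Rightarrow>\<^sub>0 nat) \<Rightarrow>\<^sub>0 'k"

definition var :: "'v \<Rightarrow> ('v, 'k::comm_ring_1) mpoly" where
  "var v = Poly_Mapping.single (Poly_Mapping.single v 1) 1"

definition ideal_of_covers :: "'v::finite set set \<Rightarrow> ('v, 'k::comm_ring_1) mpoly set" where
  "ideal_of_covers E = ideal.span {\<Prod>v\<in>C. var v | C. minimal_vertex_cover E C}"

end

theory Submission
  imports Defs "HOL-Library.Multiset"
begin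

text \<open>
  Write \<open>F\<close> for the edge set of the complement of the graph. A vertex cover is the
  complement of a clique of \<open>F\<close>; as \<open>F\<close> has neither triangles nor isolated vertices, the
  minimal vertex covers are exactly the complements of the edges of \<open>F\<close>
  (\<open>minimal_vertex_cover_iff_complement_edge\<close>). Hence a monomial \<open>t\<^sup>a\<close> lies in the
  \<open>k\<close>-th power of the ideal of covers iff there are \<open>k\<close> edges of \<open>F\<close>, repetitions allowed,
  such that every vertex \<open>v\<close> lies on at least \<open>k - a v\<close> of them
  (\<open>ideal_power_of_covers\<close>). Normality thus becomes a question about covering vertex
  demands \<open>b\<close> by \<open>k\<close> edges.

  For two odd cycles with \<open>2k\<close> vertices in total, take all demands equal to \<open>1\<close>. The
  \<open>2k\<close> edges together cover every vertex twice, so that \<open>t\<^sup>a\<close> with \<open>a = k - 1\<close> has its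
  square in the square of the \<open>k\<close>-th power. But covering an odd cycle of length \<open>m\<close>
  requires \<open>(m + 1) / 2\<close> edges, and the two roundings add up to one edge too many
  (\<open>two_odd_cycles_not_normal\<close>).

  For a single cycle, integrality of \<open>f\<close> over the \<open>k\<close>-th power is used through monomial
  valuations: for a set \<open>S\<close> of vertices, the degree in the variables of \<open>S\<close> satisfies on
  every monomial of \<open>f\<close> each lower bound that it satisfies on the power
  (\<open>integral_closure_weight_bound\<close>). For the demands
  \<open>b v = max 0 (k - a v)\<close> of a monomial of \<open>f\<close> this yields the inequalities
  \<open>\<Sum>\<^sub>S b \<le> k d\<close> whenever no edge meets \<open>S\<close> in more than \<open>d\<close> vertices. Those for stable
  sets (\<open>d = 1\<close>) and for the whole vertex set (\<open>d = 2\<close>) guarantee \<open>k\<close> covering edges, by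
  a greedy covering that starts with \<open>x\<close> copies of one edge and goes once around the
  cycle (\<open>cyclic_edge_cover\<close>, \<open>cycle_rounding\<close>).
\<close>

section \<open>Monomial ideals and integral closure\<close>

definition supported_on :: "'m set \<Rightarrow> ('m \<Rightarrow>\<^sub>0 'k::zero) set" where
  "supported_on U = {f. Poly_Mapping.keys f \<subseteq> U}"

lemma subspace_supported_on:
  fixes U :: "'m::comm_monoid_add set"
  assumes up: "\<And>a c. a \<in> U \<Longrightarrow> c + a \<in> U"
  shows "ideal.subspace (supported_on U :: ('m \<Rightarrow>\<^sub>0 'k::comm_ring_1) set)"
proof (rule ideal.subspaceI)
  show "(0 :: 'm \<Rightarrow>\<^sub>0 'k) \<in> supported_on U"
    by (simp add: supported_on_def)
next
  fix f g :: "'m \<Rightarrow>\<^sub>0 'k"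
  assume "f \<in> supported_on U" "g \<in> supported_on U"
  then show "f + g \<in> supported_on U"
    using Poly_Mapping.keys_add[of f g] by (auto simp: supported_on_def)
next
  fix c f :: "'m \<Rightarrow>\<^sub>0 'k"
  assume "f \<in> supported_on U"
  then show "c * f \<in> supported_on U"
    using keys_mult[of c f] up by (fastforce simp: supported_on_def)
qed

lemma ideal_mult_supported_on:
  fixes U1 U2 U :: "'m::comm_monoid_add set"
    and I J :: "('m \<Rightarrow>\<^sub>0 'k::comm_ring_1) set"
  assumes "I \<subseteq> supported_on U1" and "J \<subseteq> supported_on U2"
    and add: "\<And>a b. a \<in> U1 \<Longrightarrow> b \<in> U2 \<Longrightarrow> a + b \<in> U"
    and up: "\<And>a c. a \<in> U \<Longrightarrow> c + a \<in> U"
  shows "ideal_mult I J \<subseteq> supported_on U"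
  unfolding ideal_mult_def
proof (rule ideal.span_minimal[OF _ subspace_supported_on[OF up]])
  show "{a * b |a b. a \<in> I \<and> b \<in> J} \<subseteq> supported_on U"
  proof clarify
    fix f g assume "f \<in> I" "g \<in> J"
    then have "Poly_Mapping.keys f \<subseteq> U1" "Poly_Mapping.keys g \<subseteq> U2"
      using assms(1,2) by (auto simp: supported_on_def)
    then show "f * g \<in> supported_on U"
      using keys_mult[of f g] add by (fastforce simp: supported_on_def)
  qed
qed

lemma poly_mapping_sum_of_terms:
  fixes f :: "'m \<Rightarrow>\<^sub>0 'k::comm_monoid_add"
  shows "f = (\<Sum>a\<in>Poly_Mapping.keys f. Poly_Mapping.single a (Poly_Mapping.lookup f a))"
  by (rule poly_mapping_eqI)
     (auto simp: lookup_sum lookup_single when_def in_keys_iff)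

lemma supported_on_subset_ideal:
  fixes J :: "('m::comm_monoid_add \<Rightarrow>\<^sub>0 'k::comm_ring_1) set"
  assumes J: "ideal.subspace J"
    and mono: "\<And>a. a \<in> U \<Longrightarrow> Poly_Mapping.single a 1 \<in> J"
  shows "supported_on U \<subseteq> J"
proof
  fix f :: "'m \<Rightarrow>\<^sub>0 'k"
  assume f: "f \<in> supported_on U"
  have "Poly_Mapping.single a (Poly_Mapping.lookup f a) \<in> J" if "a \<in> Poly_Mapping.keys f" for a
  proof -
    have "Poly_Mapping.single a 1 \<in> J"
      using that f mono by (auto simp: supported_on_def)
    then have "Poly_Mapping.single 0 (Poly_Mapping.lookup f a) * Poly_Mapping.single a 1 \<in> J"
      by (rule ideal.subspace_scale[OF J])
    then show ?thesis by (simp add: mult_single)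
  qed
  then have "(\<Sum>a\<in>Poly_Mapping.keys f. Poly_Mapping.single a (Poly_Mapping.lookup f a)) \<in> J"
    by (intro ideal.subspace_sum[OF J]) auto
  then show "f \<in> J"
    using poly_mapping_sum_of_terms[of f] by simp
qed

lemma subspace_ideal_power: "ideal.subspace (ideal_power I n)"
  by (cases n) (simp_all add: ideal_mult_def ideal.subspace_UNIV)

lemma ideal_mult_times:
  "f \<in> I \<Longrightarrow> g \<in> J \<Longrightarrow> f * g \<in> ideal_mult I J"
  unfolding ideal_mult_def by (rule ideal.span_base) blast

text \<open>
  Reading the exponents as digits in a base larger than all of them separates the
  vectors. Such a map replaces a monomial order, for which the unordered set of
  variables offers no canonical choice.
\<close>
lemma exists_separating_additive:
  fixes A :: "('v::finite \<Rightarrow>\<^sub>0 nat) set"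
  assumes "finite A"
  shows "\<exists>\<psi> :: ('v \<Rightarrow>\<^sub>0 nat) \<Rightarrow> nat. (\<forall>a b. \<psi> (a + b) = \<psi> a + \<psi> b) \<and> inj_on \<psi> A"
proof -
  have "\<exists>\<psi> :: ('v \<Rightarrow>\<^sub>0 nat) \<Rightarrow> nat. (\<forall>a b. \<psi> (a + b) = \<psi> a + \<psi> b) \<and>
      (\<forall>a\<in>A. \<forall>b\<in>A. \<psi> a = \<psi> b \<longrightarrow> (\<forall>v\<in>T. Poly_Mapping.lookup a v = Poly_Mapping.lookup b v))" for T :: "'v set"
  proof (induction T rule: finite_induct[OF finite])
    case 1
    show ?case by (rule exI[of _ "\<lambda>_. 0"]) simp
  next
    case (2 v T)
    then obtain \<psi> :: "('v \<Rightarrow>\<^sub>0 nat) \<Rightarrow> nat" where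
      add: "\<And>a b. \<psi> (a + b) = \<psi> a + \<psi> b" and
      sep: "\<And>a b. a \<in> A \<Longrightarrow> b \<in> A \<Longrightarrow> \<psi> a = \<psi> b \<Longrightarrow> \<forall>v\<in>T. Poly_Mapping.lookup a v = Poly_Mapping.lookup b v"
      by blast
    define M where "M = Suc (\<Sum>a\<in>A. Poly_Mapping.lookup a v)"
    have M: "Poly_Mapping.lookup a v < M" if "a \<in> A" for a
      using member_le_sum[of a A "\<lambda>a. Poly_Mapping.lookup a v"] that assms by (simp add: M_def)
    define \<phi> where "\<phi> a = Poly_Mapping.lookup a v + M * \<psi> a" for a
    have "\<phi> (a + b) = \<phi> a + \<phi> b" for a b
      by (simp add: \<phi>_def add lookup_add algebra_simps)
    moreover have "\<forall>u\<in>insert v T. Poly_Mapping.lookup a u = Poly_Mapping.lookup b u"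
      if ab: "a \<in> A" "b \<in> A" and eq: "\<phi> a = \<phi> b" for a b
    proof -
      have "\<phi> a mod M = Poly_Mapping.lookup a v" "\<phi> b mod M = Poly_Mapping.lookup b v"
        "\<phi> a div M = \<psi> a" "\<phi> b div M = \<psi> b"
        using M[OF ab(1)] M[OF ab(2)] by (simp_all add: \<phi>_def)
      then show ?thesis using eq sep[OF ab] by auto
    qed
    ultimately show ?case by blast
  qed
  from this[of UNIV] obtain \<psi> :: "('v \<Rightarrow>\<^sub>0 nat) \<Rightarrow> nat" where
    add: "\<forall>a b. \<psi> (a + b) = \<psi> a + \<psi> b" and
    sep: "\<forall>a\<in>A. \<forall>b\<in>A. \<psi> a = \<psi> b \<longrightarrow> (\<forall>v\<in>UNIV. Poly_Mapping.lookup a v = Poly_Mapping.lookup b v)"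
    by blast
  have "inj_on \<psi> A"
    using sep by (intro inj_onI poly_mapping_eqI) blast
  with add show ?thesis by blast
qed

text \<open>
  The unique \<open>\<psi>\<close>-smallest term of \<open>f\<close> cannot cancel in powers of \<open>f\<close>: its \<open>n\<close>-th power is
  the unique \<open>\<psi>\<close>-smallest term of \<open>f ^ n\<close>.
\<close>
lemma power_extreme_key:
  fixes f :: "('m::comm_monoid_add) \<Rightarrow>\<^sub>0 'k::idom" and \<psi> w :: "'m \<Rightarrow> nat"
  assumes psi: "\<And>a b. \<psi> (a + b) = \<psi> a + \<psi> b" and w: "\<And>a b. w (a + b) = w a + w b"
    and a: "a \<in> Poly_Mapping.keys f" and min: "\<And>b. b \<in> Poly_Mapping.keys f \<Longrightarrow> b \<noteq> a \<Longrightarrow> \<psi> a < \<psi> b"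
  shows "\<exists>b\<in>Poly_Mapping.keys (f ^ n). w b = n * w a"
proof -
  have zero: "\<psi> 0 = 0" "w 0 = 0" using psi[of 0 0] w[of 0 0] by simp_all
  define c where "c = Poly_Mapping.lookup f a"
  define r where "r = f - Poly_Mapping.single a c"
  have c: "c \<noteq> 0" using a by (simp add: c_def in_keys_iff)
  have f: "f = Poly_Mapping.single a c + r" by (simp add: r_def)
  have r: "\<psi> a < \<psi> b" if "b \<in> Poly_Mapping.keys r" for b
  proof -
    have "b \<in> Poly_Mapping.keys f \<and> b \<noteq> a"
      using that by (auto simp: r_def in_keys_iff lookup_minus lookup_single when_def c_def split: if_splits)
    then show ?thesis using min by blast
  qed
  have "\<exists>b d g. d \<noteq> 0 \<and> f ^ n = Poly_Mapping.single b d + g \<and> w b = n * w a \<and>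
      (\<forall>x\<in>Poly_Mapping.keys g. \<psi> b < \<psi> x)"
  proof (induction n)
    case 0
    have "f ^ 0 = Poly_Mapping.single 0 1 + 0" by simp
    then show ?case by (intro exI[of _ 0] exI[of _ "1::'k"]) (auto simp: zero)
  next
    case (Suc n)
    then obtain b d g where d: "d \<noteq> 0" and eq: "f ^ n = Poly_Mapping.single b d + g"
      and wb: "w b = n * w a" and g: "\<And>x. x \<in> Poly_Mapping.keys g \<Longrightarrow> \<psi> b < \<psi> x"
      by blast
    define h where "h = Poly_Mapping.single a c * g + r * f ^ n"
    have "f ^ Suc n = Poly_Mapping.single (a + b) (c * d) + h"
    proof -
      have "f ^ Suc n = (Poly_Mapping.single a c + r) * f ^ n" by (simp flip: f)
      also have "\<dots> = Poly_Mapping.single a c * f ^ n + r * f ^ n"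
        by (simp add: distrib_right)
      also have "Poly_Mapping.single a c * f ^ n
          = Poly_Mapping.single (a + b) (c * d) + Poly_Mapping.single a c * g"
        unfolding eq by (simp add: distrib_left mult_single)
      finally show ?thesis by (simp add: h_def add.assoc)
    qed
    moreover have "\<psi> (a + b) < \<psi> x" if "x \<in> Poly_Mapping.keys h" for x
    proof -
      have "x \<in> Poly_Mapping.keys (Poly_Mapping.single a c * g) \<or> x \<in> Poly_Mapping.keys (r * f ^ n)"
        using that Poly_Mapping.keys_add[of "Poly_Mapping.single a c * g" "r * f ^ n"]
        by (auto simp: h_def)
      then consider y where "x = a + y" "y \<in> Poly_Mapping.keys g"
        | y z where "x = y + z" "y \<in> Poly_Mapping.keys r" "z \<in> Poly_Mapping.keys (f ^ n)"
        using keys_mult[of "Poly_Mapping.single a c" g] keys_mult[of r "f ^ n"] c by auto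
      then show ?thesis
      proof cases
        case 1
        then show ?thesis using g psi by simp
      next
        case 2
        have "z = b \<or> z \<in> Poly_Mapping.keys g"
          using 2(3) Poly_Mapping.keys_add[of "Poly_Mapping.single b d" g] d by (auto simp: eq)
        then have "\<psi> b \<le> \<psi> z" using g by force
        then show ?thesis using r[OF 2(2)] 2(1) psi by simp
      qed
    qed
    ultimately show ?case
      using c d wb w[of a b] by (intro exI[of _ "a + b"] exI[of _ "c * d"] exI[of _ h]) auto
  qed
  then obtain b d g where d: "d \<noteq> 0" and eq: "f ^ n = Poly_Mapping.single b d + g"
    and wb: "w b = n * w a" and g: "\<And>x. x \<in> Poly_Mapping.keys g \<Longrightarrow> \<psi> b < \<psi> x"
    by blast
  have "b \<notin> Poly_Mapping.keys g" using g by blast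
  then have "b \<in> Poly_Mapping.keys (f ^ n)"
    using d by (simp add: eq in_keys_iff lookup_add lookup_single)
  then show ?thesis using wb by blast
qed

text \<open>
  The least weight of a monomial of \<open>f\<close> is a valuation. If it were some \<open>w\<^sub>0 < D\<close>, then in
  \<open>f ^ n = - (\<Sum>i. a i * f ^ (n - i))\<close> the left-hand side would have a monomial of
  weight \<open>n w\<^sub>0\<close>, while all monomials on the right have weight at least
  \<open>i D + (n - i) w\<^sub>0 > n w\<^sub>0\<close>.
\<close>
lemma integral_closure_weight_bound:
  fixes J :: "(('v::finite \<Rightarrow>\<^sub>0 nat) \<Rightarrow>\<^sub>0 'k::idom) set" and w :: "('v \<Rightarrow>\<^sub>0 nat) \<Rightarrow> nat"
  assumes w: "\<And>a b. w (a + b) = w a + w b"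
    and J: "J \<subseteq> supported_on {a. D \<le> w a}"
  shows "integral_closure J \<subseteq> supported_on {a. D \<le> w a}"
proof
  fix f assume "f \<in> integral_closure J"
  then obtain n a where n: "n \<ge> 1" and a: "\<And>i. i \<in> {1..n} \<Longrightarrow> a i \<in> ideal_power J i"
    and eq: "f ^ n + (\<Sum>i=1..n. a i * f ^ (n - i)) = 0"
    unfolding integral_closure_def mem_Collect_eq by blast
  show "f \<in> supported_on {a. D \<le> w a}"
  proof (rule ccontr)
    assume "f \<notin> supported_on {a. D \<le> w a}"
    then obtain b0 where b0: "b0 \<in> Poly_Mapping.keys f" "w b0 < D"
      unfolding supported_on_def by (metis (mono_tags, lifting) mem_Collect_eq not_le subsetI)
    obtain \<psi>0 :: "('v \<Rightarrow>\<^sub>0 nat) \<Rightarrow> nat" where add0: "\<And>a b. \<psi>0 (a + b) = \<psi>0 a + \<psi>0 b"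
      and inj: "inj_on \<psi>0 (Poly_Mapping.keys f)"
      using exists_separating_additive[OF finite_keys, of f] by blast
    \<comment> \<open>\<open>\<psi>\<close> compares by weight first and breaks ties by the separating map.\<close>
    define N where "N = Suc (\<Sum>b\<in>Poly_Mapping.keys f. \<psi>0 b)"
    have N: "\<psi>0 b < N" if "b \<in> Poly_Mapping.keys f" for b
      using member_le_sum[of b "Poly_Mapping.keys f" \<psi>0] that by (simp add: N_def)
    define \<psi> where "\<psi> b = \<psi>0 b + N * w b" for b
    have psi: "\<psi> (b + c) = \<psi> b + \<psi> c" for b c
      by (simp add: \<psi>_def add0 w algebra_simps)
    have dm: "\<psi> b mod N = \<psi>0 b" "\<psi> b div N = w b" if "b \<in> Poly_Mapping.keys f" for b
      using N[OF that] by (simp_all add: \<psi>_def)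
    obtain b where b: "b \<in> Poly_Mapping.keys f" and le: "\<And>c. c \<in> Poly_Mapping.keys f \<Longrightarrow> \<psi> b \<le> \<psi> c"
      using ex_has_least_nat[of "\<lambda>c. c \<in> Poly_Mapping.keys f" b0 \<psi>] b0 by blast
    have strict: "\<psi> b < \<psi> c" if "c \<in> Poly_Mapping.keys f" "c \<noteq> b" for c
    proof -
      have "\<psi> b \<noteq> \<psi> c" using dm[OF b] dm[OF that(1)] inj that b by (metis inj_onD)
      then show ?thesis using le[OF that(1)] by simp
    qed
    have wmin: "w b \<le> w c" if "c \<in> Poly_Mapping.keys f" for c
      using div_le_mono[OF le[OF that], of N] dm[OF b] dm[OF that] by simp
    have wD: "w b < D" using wmin[OF b0(1)] b0(2) by simp
    obtain t where t: "t \<in> Poly_Mapping.keys (f ^ n)" "w t = n * w b"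
      using power_extreme_key[of \<psi> w b f n] psi w b strict by blast
    have f: "f \<in> supported_on {a. w b \<le> w a}"
      using wmin by (auto simp: supported_on_def)
    have fpow: "f ^ j \<in> supported_on {a. j * w b \<le> w a}" for j
    proof (induction j)
      case 0
      show ?case by (simp add: supported_on_def)
    next
      case (Suc j)
      have "x \<in> {a. Suc j * w b \<le> w a}" if x: "x \<in> Poly_Mapping.keys (f * f ^ j)" for x
      proof -
        obtain y z where "x = y + z" "y \<in> Poly_Mapping.keys f" "z \<in> Poly_Mapping.keys (f ^ j)"
          using keys_mult[of f "f ^ j"] x by blast
        then show ?thesis using wmin Suc by (force simp: supported_on_def w intro: add_mono)
      qed
      then show ?case by (auto simp: supported_on_def)
    qed
    have Jpow: "ideal_power J i \<subseteq> supported_on {a. i * D \<le> w a}" for i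
    proof (induction i)
      case 0
      show ?case by (simp add: supported_on_def)
    next
      case (Suc i)
      show ?case unfolding ideal_power.simps
        by (rule ideal_mult_supported_on[OF J Suc]) (auto simp: w)
    qed
    have "t \<notin> Poly_Mapping.keys (a i * f ^ (n - i))" if i: "i \<in> {1..n}" for i
    proof
      assume "t \<in> Poly_Mapping.keys (a i * f ^ (n - i))"
      then obtain y z where t': "t = y + z" "y \<in> Poly_Mapping.keys (a i)" "z \<in> Poly_Mapping.keys (f ^ (n - i))"
        using keys_mult by blast
      then have "i * D \<le> w y" "(n - i) * w b \<le> w z"
        using a[OF i] Jpow[of i] fpow[of "n - i"] by (auto simp: supported_on_def)
      then have "i * D + (n - i) * w b \<le> n * w b"
        using t(2) t'(1) w[of y z] by simp
      moreover have "i * w b < i * D" using i wD by simp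
      moreover have "i * w b + (n - i) * w b = n * w b"
        using i by (simp flip: distrib_right)
      ultimately show False by linarith
    qed
    then have "t \<notin> Poly_Mapping.keys (\<Sum>i=1..n. a i * f ^ (n - i))"
      using keys_sum[of "\<lambda>i. a i * f ^ (n - i)" "{1..n}"] by (auto simp: in_keys_iff lookup_sum)
    moreover have "f ^ n = - (\<Sum>i=1..n. a i * f ^ (n - i))"
      using eq by (simp add: eq_neg_iff_add_eq_0)
    ultimately show False using t(1) by (simp add: in_keys_iff)
  qed
qed

lemma subset_integral_closure:
  fixes J :: "'a::comm_ring_1 set"
  assumes "ideal.subspace J"
  shows "J \<subseteq> integral_closure J"
proof
  fix x assume "x \<in> J"
  then have "- x * 1 \<in> ideal_power J 1"
    using ideal_mult_times[of "- x" J 1 UNIV] ideal.subspace_neg[OF assms] by simp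
  then show "x \<in> integral_closure J"
    unfolding integral_closure_def
    by (intro CollectI exI[of _ 1] conjI exI[of _ "\<lambda>_. - x"]) auto
qed

lemma square_root_in_integral_closure:
  fixes J :: "'a::comm_ring_1 set"
  assumes "x * x \<in> ideal_power J 2"
  shows "x \<in> integral_closure J"
proof -
  have "- (x * x) \<in> ideal_power J 2"
    by (rule ideal.subspace_neg[OF subspace_ideal_power assms])
  moreover have "{1..2} = {1, 2::nat}" by auto
  ultimately show ?thesis
    unfolding integral_closure_def
    using ideal.subspace_0[OF subspace_ideal_power, of J 1]
    by (intro CollectI exI[of _ 2] conjI exI[of _ "\<lambda>i. if i = 1 then 0 else - (x * x)"])
       (auto simp: power2_eq_square simp del: ideal_power.simps)
qed

section \<open>Covering vertex demands on a cycle by edges\<close>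

text \<open>
  On a path whose vertices have demands \<open>b 0, b 1, \<dots>\<close>, the greedy covering uses \<open>e (Suc i)\<close>
  copies of the edge after vertex \<open>i\<close>. Its cost is certified by a stable set, read off
  backwards: if the last edge is used, then its left end vertex \<open>l\<close> is covered with
  equality, so \<open>b l\<close> pays for this edge and the one before it, and the construction
  continues two edges earlier; an unused edge is skipped.
\<close>
lemma greedy_prefix_stable_set:
  fixes b e :: "nat \<Rightarrow> nat"
  assumes step: "\<And>i. e (Suc i) = b i - e i" and e0: "e 0 = 0"
  shows "\<exists>S\<subseteq>{..<j}. (\<forall>i\<in>S. Suc i \<notin> S) \<and> (\<Sum>i\<le>j. e i) = (\<Sum>i\<in>S. b i)"
proof (induction j rule: less_induct)
  case (less j)
  show ?case
  proof (cases "j = 0")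
    case True
    then show ?thesis using e0 by (intro exI[of _ "{}"]) simp
  next
    case False
    then obtain l where l: "j = Suc l" by (cases j) auto
    show ?thesis
    proof (cases "e j = 0")
      case True
      obtain S where "S \<subseteq> {..<l}" "\<forall>i\<in>S. Suc i \<notin> S" "(\<Sum>i\<le>l. e i) = (\<Sum>i\<in>S. b i)"
        using less.IH[of l] l by auto
      then show ?thesis using True l by (intro exI[of _ S]) auto
    next
      case pos: False
      show ?thesis
      proof (cases "l = 0")
        case True
        then show ?thesis using l e0 step[of 0] by (intro exI[of _ "{0}"]) auto
      next
        case False
        then obtain h where h: "l = Suc h" by (cases l) auto
        obtain S where S: "S \<subseteq> {..<h}" "\<forall>i\<in>S. Suc i \<notin> S" "(\<Sum>i\<le>h. e i) = (\<Sum>i\<in>S. b i)"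
          using less.IH[of h] l h by auto
        have "e l + e j = b l" using step[of l] pos l by simp
        then have "(\<Sum>i\<le>j. e i) = (\<Sum>i\<in>insert l S. b i)"
          using S finite_subset[OF S(1)] l h by (subst sum.insert) auto
        then show ?thesis using S l h by (intro exI[of _ "insert l S"]) auto
      qed
    qed
  qed
qed

lemma sum_periodic_shift:
  fixes g :: "nat \<Rightarrow> 'a::cancel_comm_monoid_add"
  assumes "\<And>i. g (i + n) = g i"
  shows "(\<Sum>i<n. g (i + j)) = (\<Sum>i<n. g i)"
proof (induction j)
  case (Suc j)
  have "g j + (\<Sum>i<n. g (i + Suc j)) = (\<Sum>i<Suc n. g (i + j))"
    by (subst sum.lessThan_Suc_shift) simp
  also have "\<dots> = g j + (\<Sum>i<n. g (i + j))"
    using assms[of j] by (simp add: add.commute)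
  finally show ?case using Suc by simp
qed simp

text \<open>
  The greedy covering that starts with \<open>x\<close> copies of the edge entering vertex \<open>0\<close>. Going
  once around a cycle of length \<open>n\<close>, it asks for \<open>greedy b x n\<close> copies of this very edge,
  so that a covering of the cycle results when \<open>greedy b x n \<le> x\<close>.
\<close>
primrec greedy :: "(nat \<Rightarrow> nat) \<Rightarrow> nat \<Rightarrow> nat \<Rightarrow> nat" where
  "greedy b x 0 = x"
| "greedy b x (Suc i) = b i - greedy b x i"

lemma greedy_periodic:
  assumes "\<And>i. b (i + n) = b i" and "greedy b x n = x"
  shows "greedy b x (i + n) = greedy b x i"
  by (induction i) (simp_all add: assms)

text \<open>Each step is the composition of a reflection and a truncation at \<open>0\<close>.\<close>
lemma greedy_contraction:
  assumes "i \<le> j"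
  shows "\<bar>int (greedy b x j) - int (greedy b y j)\<bar> \<le> \<bar>int (greedy b x i) - int (greedy b y i)\<bar>"
  using assms by (induction j rule: dec_induct) auto

text \<open>
  Without truncation every demand is met with equality, and every edge except the first
  and the last is counted at both of its ends.
\<close>
lemma greedy_sum:
  assumes "\<And>i. i < n \<Longrightarrow> greedy b x i \<le> b i"
  shows "(\<Sum>i<n. b i) + x = 2 * (\<Sum>i<n. greedy b x i) + greedy b x n"
proof -
  have "(\<Sum>i<m. b i) + x = 2 * (\<Sum>i<m. greedy b x i) + greedy b x m" if "m \<le> n" for m
    using that
  proof (induction m)
    case (Suc m)
    then show ?case using assms[of m] by simp
  qed simp
  then show ?thesis by simp
qed

text \<open>
  If the map \<open>x \<mapsto> greedy b x n\<close> has a fixed point, the resulting cyclic covering either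
  has no truncation and costs \<open>(\<Sum> b) / 2\<close>, or it has an unused edge; cutting the cycle
  there leaves a path, whose covering costs the demand of a stable set. If there is no
  fixed point, consider the least \<open>x\<close> with \<open>greedy b x n \<le> x\<close>. The map does not increase
  distances, so it must interchange \<open>x - 1\<close> and \<open>x\<close>. Then the distance is kept in every
  step, which excludes truncation, and the covering costs \<open>(\<Sum> b + 1) / 2\<close>.

  The set \<open>S\<close> in the hypothesis omits the last position \<open>n - 1\<close>, so that its positions are
  also cyclically non-consecutive.
\<close>
lemma cyclic_edge_cover:
  fixes b :: "nat \<Rightarrow> nat"
  assumes n: "n > 0" and per: "\<And>i. b (i + n) = b i"
    and stable: "\<And>j S. S \<subseteq> {..<n - 1} \<Longrightarrow> (\<forall>i\<in>S. Suc i \<notin> S) \<Longrightarrow> (\<Sum>i\<in>S. b (i + j)) \<le> k"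
    and total: "(\<Sum>i<n. b i) \<le> 2 * k"
  shows "\<exists>e. e n \<le> e 0 \<and> (\<forall>i<n. b i \<le> e i + e (Suc i)) \<and> (\<Sum>i<n. e i) \<le> k"
proof (cases "\<exists>x. greedy b x n = x")
  case True
  then obtain x where x: "greedy b x n = x" by blast
  define e where "e = greedy b x"
  have ep: "e (i + n) = e i" for i
    unfolding e_def by (rule greedy_periodic[OF per x])
  have step: "e (Suc i) = b i - e i" for i by (simp add: e_def)
  have "(\<Sum>i<n. e i) \<le> k"
  proof (cases "\<forall>i<n. e i \<le> b i")
    case True
    then have "(\<Sum>i<n. b i) + x = 2 * (\<Sum>i<n. e i) + x"
      using greedy_sum[of n b x] x by (simp add: e_def)
    then show ?thesis using total by simp
  next
    case False
    then obtain i where "b i < e i" by (auto simp: not_le)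
    then have z: "e (Suc i) = 0" by (simp add: step)
    define j where "j = Suc i"
    obtain m where m: "n = Suc m" using n by (cases n) auto
    \<comment> \<open>The edge \<open>j\<close> is unused: cut the cycle there.\<close>
    obtain S where S: "S \<subseteq> {..<m}" "\<forall>i\<in>S. Suc i \<notin> S"
      and eq: "(\<Sum>i\<le>m. e (i + j)) = (\<Sum>i\<in>S. b (i + j))"
      using greedy_prefix_stable_set[of "\<lambda>i. e (i + j)" "\<lambda>i. b (i + j)" m] step z j_def by auto
    have "(\<Sum>i<n. e i) = (\<Sum>i<n. e (i + j))"
      by (rule sum_periodic_shift[of e n j, OF ep, symmetric])
    also have "\<dots> = (\<Sum>i\<in>S. b (i + j))" using eq m by (simp add: lessThan_Suc_atMost)
    also have "\<dots> \<le> k" using stable S m by simp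
    finally show ?thesis .
  qed
  moreover have "e n \<le> e 0" using ep[of 0] by simp
  ultimately show ?thesis using step by (intro exI[of _ e]) auto
next
  case False
  obtain m where m: "n = Suc m" using n by (cases n) auto
  define x where "x = (LEAST x. greedy b x n \<le> x)"
  have x: "greedy b x n \<le> x"
    unfolding x_def by (rule LeastI[of _ "b m"]) (simp add: m)
  then have "x \<noteq> 0" using False by (metis le_zero_eq)
  have prev: "\<not> greedy b (x - 1) n \<le> x - 1"
    using not_less_Least[of "x - 1" "\<lambda>x. greedy b x n \<le> x"] \<open>x \<noteq> 0\<close> by (simp add: x_def)
  have lt: "greedy b x n < x" using x False by (metis le_neq_implies_less)
  have diff: "\<bar>int (greedy b x i) - int (greedy b (x - 1) i)\<bar> = 1" if "i \<le> n" for i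
    using greedy_contraction[of 0 i b x "x - 1"] greedy_contraction[OF that, of b x "x - 1"]
      prev lt \<open>x \<noteq> 0\<close> by auto
  have end_value: "greedy b x n = x - 1"
    using diff[of n] prev lt \<open>x \<noteq> 0\<close> by auto
  \<comment> \<open>A truncation at \<open>x\<close> with neighbouring values at distance \<open>1\<close> would make the next
    values for \<open>x\<close> and \<open>x - 1\<close> coincide.\<close>
  have "greedy b x i \<le> b i" if "i < n" for i
    using diff[of i] diff[of "Suc i"] that by auto
  then have "(\<Sum>i<n. b i) + x = 2 * (\<Sum>i<n. greedy b x i) + (x - 1)"
    using greedy_sum[of n b x] end_value by simp
  then have "(\<Sum>i<n. greedy b x i) \<le> k" using total \<open>x \<noteq> 0\<close> by linarith
  then show ?thesis using x by (intro exI[of _ "greedy b x"]) auto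
qed

section \<open>Powers of the ideal of covers\<close>

definition edge_count :: "'v set multiset \<Rightarrow> 'v \<Rightarrow> nat" where
  "edge_count M v = size (filter_mset (\<lambda>e. v \<in> e) M)"

lemma edge_count_simps [simp]:
  "edge_count {#} v = 0"
  "edge_count (M + N) v = edge_count M v + edge_count N v"
  "edge_count (add_mset e M) v = of_bool (v \<in> e) + edge_count M v"
  by (simp_all add: edge_count_def)

lemma edge_count_le_size: "edge_count M v \<le> size M"
  by (simp add: edge_count_def size_filter_mset_lesseq)

lemma edge_count_pos: "edge_count M v > 0 \<longleftrightarrow> (\<exists>e\<in>#M. v \<in> e)"
  by (induction M) auto

lemma sum_edge_count:
  assumes "finite S"
  shows "(\<Sum>v\<in>S. edge_count M v) = (\<Sum>e\<in>#M. card (S \<inter> e))"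
  using assms by (induction M) (simp_all add: sum.distrib sum_of_bool_eq Int_def)

text \<open>
  A product of \<open>k\<close> generators omits the variable \<open>v\<close> once for each of the corresponding
  edges that contain \<open>v\<close>. So the monomial of \<open>a\<close> is divisible by the product iff \<open>a v\<close>
  plus the number of these edges is at least \<open>k\<close> for every \<open>v\<close>; the additive form avoids
  truncated subtraction.
\<close>
definition power_exponents :: "'v::finite set set \<Rightarrow> nat \<Rightarrow> ('v \<Rightarrow>\<^sub>0 nat) set" where
  "power_exponents F k = {a. \<exists>M. set_mset M \<subseteq> F \<and> size M = k \<and>
     (\<forall>v. k \<le> Poly_Mapping.lookup a v + edge_count M v)}"

lemma power_exponents_add:
  assumes "a \<in> power_exponents F j" and "b \<in> power_exponents F k"
  shows "a + b \<in> power_exponents F (j + k)"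
proof -
  obtain M N where MN: "set_mset M \<subseteq> F" "size M = j" "set_mset N \<subseteq> F" "size N = k"
    and M: "\<And>v. j \<le> Poly_Mapping.lookup a v + edge_count M v"
    and N: "\<And>v. k \<le> Poly_Mapping.lookup b v + edge_count N v"
    using assms by (auto simp: power_exponents_def)
  have "j + k \<le> Poly_Mapping.lookup (a + b) v + edge_count (M + N) v" for v
    using add_mono[OF M[of v] N[of v]] by (simp add: lookup_add algebra_simps)
  then show ?thesis
    unfolding power_exponents_def using MN by (intro CollectI exI[of _ "M + N"]) auto
qed

lemma power_exponents_up: "a \<in> power_exponents F k \<Longrightarrow> c + a \<in> power_exponents F k"
  by (auto simp: power_exponents_def lookup_add intro: trans_le_add2 simp: add.assoc)

definition exponent :: "('v::finite \<Rightarrow> nat) \<Rightarrow> 'v \<Rightarrow>\<^sub>0 nat" where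
  "exponent = Abs_poly_mapping"

lemma lookup_exponent [simp]: "Poly_Mapping.lookup (exponent g) v = g v"
  by (simp add: exponent_def)

lemma prod_var:
  "(\<Prod>v\<in>C. var v) = (Poly_Mapping.single (exponent (\<lambda>v. of_bool (v \<in> C))) 1 :: ('v::finite, 'k::comm_ring_1) mpoly)"
proof (induction C rule: finite_induct[OF finite])
  case 1
  have "exponent (\<lambda>v::'v. of_bool (v \<in> {})) = 0" by (rule poly_mapping_eqI) simp
  then show ?case by simp
next
  case (2 u C)
  have "Poly_Mapping.single u 1 + exponent (\<lambda>v. of_bool (v \<in> C)) = exponent (\<lambda>v. of_bool (v \<in> insert u C))"
    using 2 by (intro poly_mapping_eqI) (auto simp: lookup_add lookup_single when_def)
  then show ?case using 2 by (simp add: var_def mult_single)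
qed

lemma vertex_cover_iff_complement_clique:
  assumes "simple_graph E"
  shows "vertex_cover E C \<longleftrightarrow> (\<forall>u v. u \<notin> C \<longrightarrow> v \<notin> C \<longrightarrow> u \<noteq> v \<longrightarrow> {u, v} \<in> complement_graph E)"
proof
  assume C: "vertex_cover E C"
  show "\<forall>u v. u \<notin> C \<longrightarrow> v \<notin> C \<longrightarrow> u \<noteq> v \<longrightarrow> {u, v} \<in> complement_graph E"
  proof (intro allI impI)
    fix u v assume "u \<notin> C" "v \<notin> C" "u \<noteq> v"
    then have "{u, v} \<notin> E" using C by (auto simp: vertex_cover_def)
    then show "{u, v} \<in> complement_graph E"
      using \<open>u \<noteq> v\<close> by (auto simp: complement_graph_def)
  qed
next
  assume *: "\<forall>u v. u \<notin> C \<longrightarrow> v \<notin> C \<longrightarrow> u \<noteq> v \<longrightarrow> {u, v} \<in> complement_graph E"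
  show "vertex_cover E C"
    unfolding vertex_cover_def
  proof (intro ballI notI)
    fix e assume e: "e \<in> E" "e \<inter> C = {}"
    then obtain u v where uv: "e = {u, v}" "u \<noteq> v"
      using assms by (auto simp: simple_graph_def card_2_iff)
    then have "e \<in> complement_graph E" using * e by auto
    then show False using e(1) by (auto simp: complement_graph_def)
  qed
qed

definition triangle_free :: "'v set set \<Rightarrow> bool" where
  "triangle_free F \<longleftrightarrow> (\<forall>x y z. x \<noteq> y \<longrightarrow> y \<noteq> z \<longrightarrow> x \<noteq> z \<longrightarrow>
     {x, y} \<in> F \<longrightarrow> {y, z} \<in> F \<longrightarrow> {x, z} \<notin> F)"

text \<open>
  The complements of minimal vertex covers are the maximal cliques, and in a
  triangle-free graph without isolated vertices these are the edges.
\<close>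
lemma minimal_vertex_cover_iff_complement_edge:
  fixes E :: "'v::finite set set"
  assumes E: "simple_graph E" and tf: "triangle_free (complement_graph E)"
    and cover: "\<Union> (complement_graph E) = UNIV"
  shows "minimal_vertex_cover E C \<longleftrightarrow> - C \<in> complement_graph E"
proof
  let ?F = "complement_graph E"
  assume "minimal_vertex_cover E C"
  then have C: "vertex_cover E C" and min: "\<And>D. D \<subset> C \<Longrightarrow> \<not> vertex_cover E D"
    by (auto simp: minimal_vertex_cover_def)
  have clique: "{u, v} \<in> ?F" if "u \<notin> C" "v \<notin> C" "u \<noteq> v" for u v
    using C that vertex_cover_iff_complement_clique[OF E] by blast
  have "\<exists>u v. u \<notin> C \<and> v \<notin> C \<and> u \<noteq> v"
  proof (rule ccontr)
    assume "\<not> ?thesis"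
    then have eq: "u = v" if "u \<notin> C" "v \<notin> C" for u v using that by blast
    obtain u where u: "\<And>v. v \<notin> C \<Longrightarrow> v = u" using eq by blast
    obtain e where "e \<in> ?F" "u \<in> e" using cover by blast
    then obtain x y where "x \<noteq> y" "{x, y} \<in> ?F" "u \<in> {x, y}"
      by (auto simp: complement_graph_def)
    then obtain v where v: "v \<noteq> u" "{u, v} \<in> ?F"
      by (metis insertE insert_commute singletonD)
    have "vertex_cover E (C - {u, v})"
      unfolding vertex_cover_iff_complement_clique[OF E]
      using u v by (auto simp: insert_commute)
    moreover have "v \<in> C" using u v by blast
    ultimately show False using min[of "C - {u, v}"] by blast
  qed
  then obtain u v where uv: "u \<notin> C" "v \<notin> C" "u \<noteq> v" by blast
  have "- C = {u, v}"
  proof (rule ccontr)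
    assume "- C \<noteq> {u, v}"
    then obtain w where "w \<notin> C" "w \<noteq> u" "w \<noteq> v" using uv by blast
    then show False using tf uv clique unfolding triangle_free_def by metis
  qed
  then show "- C \<in> ?F" using clique uv by simp
next
  let ?F = "complement_graph E"
  assume C: "- C \<in> ?F"
  then obtain u v where uv: "- C = {u, v}" "u \<noteq> v" by (auto simp: complement_graph_def)
  have "vertex_cover E C"
    unfolding vertex_cover_iff_complement_clique[OF E]
  proof (intro allI impI)
    fix x y assume "x \<notin> C" "y \<notin> C" "x \<noteq> y"
    then have "x \<in> {u, v}" "y \<in> {u, v}" unfolding uv(1)[symmetric] by simp_all
    then have "{x, y} = - C" unfolding uv(1) using \<open>x \<noteq> y\<close> by auto
    then show "{x, y} \<in> ?F" using C by simp
  qed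
  moreover have "\<not> vertex_cover E D" if D: "D \<subset> C" for D
  proof
    assume "vertex_cover E D"
    then have clique: "{x, y} \<in> ?F" if "x \<notin> D" "y \<notin> D" "x \<noteq> y" for x y
      using that vertex_cover_iff_complement_clique[OF E] by blast
    obtain w where "w \<in> C" "w \<notin> D" using D by blast
    moreover have "u \<notin> C" "v \<notin> C" using uv by auto
    ultimately have "w \<notin> D" "u \<notin> D" "v \<notin> D" "w \<noteq> u" "w \<noteq> v" using D by auto
    then show False using tf uv(2) clique unfolding triangle_free_def by metis
  qed
  ultimately show "minimal_vertex_cover E C" by (simp add: minimal_vertex_cover_def)
qed

lemma monomial_mem_cover_power:
  fixes E F :: "'v::finite set set"
  assumes gens: "\<And>C. minimal_vertex_cover E C \<longleftrightarrow> - C \<in> F"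
    and "set_mset M \<subseteq> F" and "\<And>v. size M \<le> Poly_Mapping.lookup a v + edge_count M v"
  shows "(Poly_Mapping.single a 1 :: ('v, 'k::comm_ring_1) mpoly) \<in> ideal_power (ideal_of_covers E) (size M)"
  using assms(2,3)
proof (induction M arbitrary: a)
  case empty
  then show ?case by simp
next
  case (add e M)
  define x where "x = exponent (\<lambda>v. of_bool (v \<in> - e))"
  define c where "c = exponent (\<lambda>v. Poly_Mapping.lookup a v - of_bool (v \<in> - e))"
  have bound: "Suc (size M) \<le> Poly_Mapping.lookup a v + (of_bool (v \<in> e) + edge_count M v)" for v
    using add.prems(2)[of v] by simp
  have pos: "of_bool (v \<in> - e) \<le> Poly_Mapping.lookup a v" for v
    using bound[of v] edge_count_le_size[of M v] by (cases "v \<in> e") auto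
  have a: "a = x + c"
    using pos by (intro poly_mapping_eqI) (simp add: x_def c_def lookup_add)
  have "size M \<le> Poly_Mapping.lookup c v + edge_count M v" for v
    using bound[of v] by (auto simp: c_def)
  then have "(Poly_Mapping.single c 1 :: ('v, 'k) mpoly) \<in> ideal_power (ideal_of_covers E) (size M)"
    using add by simp
  moreover have "(Poly_Mapping.single x 1 :: ('v, 'k) mpoly) \<in> ideal_of_covers E"
    unfolding ideal_of_covers_def x_def prod_var[symmetric]
    using gens[of "- e"] add.prems(1) by (intro ideal.span_base) auto
  ultimately have "Poly_Mapping.single x 1 * (Poly_Mapping.single c 1 :: ('v, 'k) mpoly)
      \<in> ideal_power (ideal_of_covers E) (Suc (size M))"
    by (simp add: ideal_mult_times)
  then show ?case by (simp add: mult_single a)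
qed

lemma power_exponentsI:
  "set_mset M \<subseteq> F \<Longrightarrow> size M = k \<Longrightarrow>
    (\<And>v. k \<le> Poly_Mapping.lookup a v + edge_count M v) \<Longrightarrow> a \<in> power_exponents F k"
  unfolding power_exponents_def by blast

lemma ideal_power_of_covers:
  fixes E F :: "'v::finite set set"
  assumes gens: "\<And>C. minimal_vertex_cover E C \<longleftrightarrow> - C \<in> F"
  shows "ideal_power (ideal_of_covers E :: ('v, 'k::comm_ring_1) mpoly set) k
    = supported_on (power_exponents F k)"
proof
  have "exponent (\<lambda>v. of_bool (v \<in> C)) \<in> power_exponents F 1" if "minimal_vertex_cover E C" for C
    by (rule power_exponentsI[of "{#- C#}"]) (use that gens in auto)
  then have I: "(ideal_of_covers E :: ('v, 'k) mpoly set) \<subseteq> supported_on (power_exponents F 1)"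
    unfolding ideal_of_covers_def
    by (intro ideal.span_minimal subspace_supported_on power_exponents_up)
      (auto simp: prod_var supported_on_def)
  show "ideal_power (ideal_of_covers E :: ('v, 'k) mpoly set) k \<subseteq> supported_on (power_exponents F k)"
  proof (induction k)
    case 0
    show ?case by (auto simp: supported_on_def power_exponents_def)
  next
    case (Suc k)
    show ?case unfolding ideal_power.simps
      by (rule ideal_mult_supported_on[OF I Suc])
         (use power_exponents_add[of _ F 1 _ k] in \<open>auto intro: power_exponents_up\<close>)
  qed
  show "supported_on (power_exponents F k) \<subseteq> ideal_power (ideal_of_covers E :: ('v, 'k) mpoly set) k"
  proof (rule supported_on_subset_ideal[OF subspace_ideal_power])
    fix a assume "a \<in> power_exponents F k"
    then obtain M where "set_mset M \<subseteq> F" "size M = k"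
      "\<forall>v. k \<le> Poly_Mapping.lookup a v + edge_count M v"
      by (auto simp: power_exponents_def)
    then show "(Poly_Mapping.single a 1 :: ('v, 'k) mpoly) \<in> ideal_power (ideal_of_covers E) k"
      using monomial_mem_cover_power[OF gens, of M a] by auto
  qed
qed

lemma sum_edge_count_le:
  assumes "finite S" "set_mset M \<subseteq> F" "\<And>e. e \<in> F \<Longrightarrow> card (S \<inter> e) \<le> d"
  shows "(\<Sum>v\<in>S. edge_count M v) \<le> size M * d"
  unfolding sum_edge_count[OF assms(1)]
  using assms(2,3) by (induction M) (auto intro: add_mono)

text \<open>
  The hypothesis is an integer rounding property: the inequalities on \<open>b\<close> are necessary for
  a fractional covering by \<open>k\<close> edges, and they must suffice for an integral one. For a
  monomial in the integral closure they follow, with \<open>b = k - a\<close>, from the weights that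
  sum the exponents over a set of vertices.
\<close>
lemma normal_ideal_of_coversI:
  fixes E F :: "'v::finite set set"
  assumes gens: "\<And>C. minimal_vertex_cover E C \<longleftrightarrow> - C \<in> F"
    and rounding: "\<And>b k. (\<And>S d. (\<forall>e\<in>F. card (S \<inter> e) \<le> d) \<Longrightarrow> (\<Sum>v\<in>S. b v) \<le> k * d) \<Longrightarrow>
      \<exists>M. set_mset M \<subseteq> F \<and> size M = k \<and> (\<forall>v. b v \<le> edge_count M v)"
  shows "normal_ideal (ideal_of_covers E :: ('v, 'k::idom) mpoly set)"
  unfolding normal_ideal_def
proof (intro allI impI equalityI subset_integral_closure subspace_ideal_power subsetI)
  let ?I = "ideal_of_covers E :: ('v, 'k) mpoly set"
  fix k f assume f: "f \<in> integral_closure (ideal_power ?I k)"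
  have "a \<in> power_exponents F k" if a: "a \<in> Poly_Mapping.keys f" for a
  proof -
    have "(\<Sum>v\<in>S. k - Poly_Mapping.lookup a v) \<le> k * d" if d: "\<forall>e\<in>F. card (S \<inter> e) \<le> d" for S d
    proof -
      \<comment> \<open>The demand \<open>k - a v\<close> is truncated at \<open>0\<close>; on \<open>T\<close> it is not, and outside \<open>T\<close> it vanishes.\<close>
      define T where "T = {v \<in> S. Poly_Mapping.lookup a v < k}"
      define w where "w c = (\<Sum>v\<in>T. Poly_Mapping.lookup c v)" for c :: "'v \<Rightarrow>\<^sub>0 nat"
      have "card (T \<inter> e) \<le> d" if "e \<in> F" for e
        using d that card_mono[of "S \<inter> e" "T \<inter> e"] by (force simp: T_def)
      then have dT: "(\<Sum>v\<in>T. edge_count M v) \<le> size M * d" if "set_mset M \<subseteq> F" for M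
        using sum_edge_count_le[of T M F d] that by simp
      have "k * card T - k * d \<le> w c" if c: "c \<in> power_exponents F k" for c
      proof -
        obtain M where M: "set_mset M \<subseteq> F" "size M = k"
          "\<forall>v. k \<le> Poly_Mapping.lookup c v + edge_count M v"
          using c by (auto simp: power_exponents_def)
        have "k * card T = (\<Sum>v\<in>T. k)" by simp
        also have "\<dots> \<le> (\<Sum>v\<in>T. Poly_Mapping.lookup c v + edge_count M v)"
          using M(3) by (intro sum_mono) auto
        also have "\<dots> = w c + (\<Sum>v\<in>T. edge_count M v)" by (simp add: w_def sum.distrib)
        finally show ?thesis using dT[OF M(1)] M(2) by simp
      qed
      then have "ideal_power ?I k \<subseteq> supported_on {c. k * card T - k * d \<le> w c}"
        unfolding ideal_power_of_covers[OF gens] by (auto simp: supported_on_def)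
      then have "integral_closure (ideal_power ?I k) \<subseteq> supported_on {c. k * card T - k * d \<le> w c}"
        by (intro integral_closure_weight_bound) (simp_all add: w_def lookup_add sum.distrib)
      then have "k * card T - k * d \<le> w a"
        using f a by (auto simp: supported_on_def)
      moreover have "(\<Sum>v\<in>T. k - Poly_Mapping.lookup a v) + w a = (\<Sum>v\<in>T. k)"
        unfolding w_def sum.distrib[symmetric] by (rule sum.cong) (auto simp: T_def)
      moreover have "(\<Sum>v\<in>S. k - Poly_Mapping.lookup a v) = (\<Sum>v\<in>T. k - Poly_Mapping.lookup a v)"
        by (rule sum.mono_neutral_right) (auto simp: T_def)
      ultimately show ?thesis by (simp add: mult.commute)
    qed
    then obtain M where "set_mset M \<subseteq> F" "size M = k" "\<forall>v. k - Poly_Mapping.lookup a v \<le> edge_count M v"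
      using rounding[of "\<lambda>v. k - Poly_Mapping.lookup a v" k] by blast
    then show ?thesis by (intro power_exponentsI[of M]) (auto simp: add.commute le_diff_conv)
  qed
  then show "f \<in> ideal_power ?I k"
    unfolding ideal_power_of_covers[OF gens] by (auto simp: supported_on_def)
qed

section \<open>Cycles\<close>

lemma cycle_triangle_free:
  assumes "cycle_graph n W F" and "n \<ge> 4"
  shows "triangle_free F"
proof -
  obtain f where f: "bij_betw f {..<n} W" and F: "F = (\<lambda>i. {f i, f (Suc i mod n)}) ` {..<n}"
    using assms by (auto simp: cycle_graph_def)
  have next_mod: "Suc i mod n = (if Suc i = n then 0 else Suc i)" if "i < n" for i
    using that by auto
  have adj: "j = Suc i mod n \<or> i = Suc j mod n" if ij: "i < n" "j < n" "{f i, f j} \<in> F" for i j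
  proof -
    obtain l where l: "l < n" "{f i, f j} = {f l, f (Suc l mod n)}" using ij(3) F by auto
    have inj: "f p = f q \<longleftrightarrow> p = q" if "p < n" "q < n" for p q
      using f that by (auto simp: bij_betw_def inj_on_def)
    have "Suc l mod n < n" using l(1) by simp
    then show ?thesis using l ij(1,2) inj by (auto simp: doubleton_eq_iff)
  qed
  have vertex: "\<exists>i<n. x = f i" if xe: "e \<in> F" "x \<in> e" for x e
  proof -
    obtain l where l: "l < n" "x = f l \<or> x = f (Suc l mod n)" using xe F by auto
    moreover have "Suc l mod n < n" using l(1) by simp
    ultimately show ?thesis by blast
  qed
  show ?thesis
    unfolding triangle_free_def
  proof (intro allI impI notI)
    fix x y z assume ne: "x \<noteq> y" "y \<noteq> z" "x \<noteq> z"
      and e: "{x, y} \<in> F" "{y, z} \<in> F" "{x, z} \<in> F"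
    obtain i j l where ijl: "x = f i" "y = f j" "z = f l" "i < n" "j < n" "l < n"
      using vertex[OF e(1), of x] vertex[OF e(1), of y] vertex[OF e(2), of z] by auto
    have "j = Suc i mod n \<or> i = Suc j mod n" "l = Suc j mod n \<or> j = Suc l mod n"
      "l = Suc i mod n \<or> i = Suc l mod n"
      using adj e ijl by auto
    moreover have "i \<noteq> j" "j \<noteq> l" "i \<noteq> l" using ne ijl by auto
    ultimately show False using ijl(4-6) \<open>n \<ge> 4\<close> by (auto simp: next_mod split: if_splits)
  qed
qed

lemma cycle_Union:
  assumes "cycle_graph n W F"
  shows "\<Union> F = W"
proof -
  obtain f where f: "bij_betw f {..<n} W" and F: "F = (\<lambda>i. {f i, f (Suc i mod n)}) ` {..<n}"
    using assms by (auto simp: cycle_graph_def)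
  then have "W = f ` {..<n}" by (simp add: bij_betw_def)
  then show ?thesis using F by (force intro: imageI)
qed

lemma cycle_edge_card:
  assumes "cycle_graph n W F" and "e \<in> F"
  shows "card e \<le> 2"
  using assms by (auto simp: cycle_graph_def card_insert_if)

lemma edge_count_sum_replicate:
  assumes "finite A"
  shows "edge_count (\<Sum>i\<in>A. replicate_mset (w i) (g i)) v = (\<Sum>i\<in>{i\<in>A. v \<in> g i}. w i)"
proof -
  have *: "edge_count (replicate_mset m e) v = (if v \<in> e then m else 0)" for m :: nat and e
    by (induction m) auto
  have "edge_count (\<Sum>i\<in>A. replicate_mset (w i) (g i)) v = (\<Sum>i\<in>A. if v \<in> g i then w i else 0)"
    using assms by (induction A rule: finite_induct) (simp_all add: *)
  also have "\<dots> = (\<Sum>i\<in>{i\<in>A. v \<in> g i}. w i)"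
    using assms by (simp add: sum.inter_filter)
  finally show ?thesis .
qed

text \<open>
  Passage from a weight on the positions of a cycle to a multiset of edges: the vertex at
  position \<open>Suc i\<close> lies on the edges \<open>i\<close> and \<open>Suc i\<close> only.
\<close>
lemma cycle_weighting:
  assumes "n \<ge> 2" and f: "inj_on f {..<n}" and F: "F = (\<lambda>i. {f i, f (Suc i mod n)}) ` {..<n}"
  shows "\<exists>M. set_mset M \<subseteq> F \<and> size M = (\<Sum>i<n. w i) \<and>
    (\<forall>i<n. edge_count M (f (Suc i mod n)) = w i + w (Suc i mod n))"
proof -
  define g where "g i = {f i, f (Suc i mod n)}" for i
  define M where "M = (\<Sum>i<n. replicate_mset (w i) (g i))"
  have "set_mset M = (\<Union>i<n. set_mset (replicate_mset (w i) (g i)))"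
    unfolding M_def by (rule set_mset_sum) simp
  then have "set_mset M \<subseteq> F"
    using F by (auto simp: g_def split: if_splits)
  moreover have "size M = (\<Sum>i<n. w i)"
    unfolding M_def by (simp add: size_multiset_sum)
  moreover have "edge_count M (f (Suc i mod n)) = w i + w (Suc i mod n)" if "i < n" for i
  proof -
    have inj: "f p = f q \<longleftrightarrow> p = q" if "p < n" "q < n" for p q
      using f that by (auto simp: inj_on_def)
    have less: "Suc j mod n < n" for j using \<open>n \<ge> 2\<close> by simp
    have next_mod: "Suc j mod n = (if Suc j = n then 0 else Suc j)" if "j < n" for j
      using that by auto
    have "{j \<in> {..<n}. f (Suc i mod n) \<in> g j} = {i, Suc i mod n}"
      using that less inj by (auto simp: g_def) (auto simp: next_mod split: if_splits)
    moreover have "i \<noteq> Suc i mod n" using that \<open>n \<ge> 2\<close> by (auto simp: next_mod)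
    ultimately show ?thesis by (simp add: M_def edge_count_sum_replicate)
  qed
  ultimately show ?thesis by blast
qed

lemma inj_on_add_mod: "inj_on (\<lambda>i. (i + j) mod n) {..<n::nat}"
proof (rule inj_onI)
  fix x y assume "x \<in> {..<n}" "y \<in> {..<n}" "(x + j) mod n = (y + j) mod n"
  then show "x = y"
  proof (induction x y rule: linorder_wlog)
    case (le x y)
    then have "n dvd y - x" using mod_eq_dvd_iff_nat[of "x + j" "y + j" n] by simp
    moreover have "y - x < n" using le by auto
    ultimately have "y - x = 0" using nat_dvd_not_less by blast
    then show ?case using le by simp
  next
    case (sym x y)
    then show ?case by simp
  qed
qed

text \<open>
  The stable sets and the whole cycle provide the two hypotheses of
  \<open>cyclic_edge_cover\<close>. A covering with fewer than \<open>k\<close> edges is padded by copies of an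
  arbitrary edge.
\<close>
lemma cycle_rounding:
  fixes b :: "'v \<Rightarrow> nat"
  assumes cycle: "cycle_graph n W F"
    and fractional: "\<And>S d. S \<subseteq> W \<Longrightarrow> (\<forall>e\<in>F. card (S \<inter> e) \<le> d) \<Longrightarrow> (\<Sum>v\<in>S. b v) \<le> k * d"
  shows "\<exists>M. set_mset M \<subseteq> F \<and> size M = k \<and> (\<forall>v\<in>W. b v \<le> edge_count M v)"
proof -
  obtain f where bij: "bij_betw f {..<n} W" and F: "F = (\<lambda>i. {f i, f (Suc i mod n)}) ` {..<n}"
    and n: "n \<ge> 3"
    using cycle by (auto simp: cycle_graph_def)
  have inj: "inj_on f {..<n}" and W: "W = f ` {..<n}" using bij by (auto simp: bij_betw_def)
  define c where "c i = b (f (i mod n))" for i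
  have stable: "(\<Sum>i\<in>S. c (i + j)) \<le> k" if S: "S \<subseteq> {..<n - 1}" "\<forall>i\<in>S. Suc i \<notin> S" for S j
  proof -
    define h where "h i = f ((i + j) mod n)" for i
    have h: "inj_on h {..<n}"
      unfolding h_def using n
      by (intro inj_onI) (auto dest!: inj_onD[OF inj] inj_onD[OF inj_on_add_mod])
    have "card (h ` S \<inter> e) \<le> 1" if e: "e \<in> F" for e
    proof -
      obtain l where l: "l < n" "e = {f l, f (Suc l mod n)}" using e F by auto
      have "\<not> e \<subseteq> h ` S"
      proof
        assume "e \<subseteq> h ` S"
        then obtain i i' where i: "i \<in> S" "f l = h i" "i' \<in> S" "f (Suc l mod n) = h i'"
          using l by auto
        have "l = (i + j) mod n" "Suc l mod n = (i' + j) mod n"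
          using i l(1) n inj_onD[OF inj] by (auto simp: h_def)
        then have "(Suc i + j) mod n = (i' + j) mod n" by (simp add: mod_Suc_eq)
        moreover have "Suc i < n" "i' < n" using i S(1) by force+
        ultimately have "Suc i = i'" using inj_onD[OF inj_on_add_mod, of "Suc i" j n i'] by simp
        then show False using i S(2) by blast
      qed
      then have "h ` S \<inter> e \<subset> e" by blast
      then have "card (h ` S \<inter> e) < card e" using l by (intro psubset_card_mono) auto
      then show ?thesis using cycle_edge_card[OF cycle e] by simp
    qed
    moreover have "h ` S \<subseteq> W" using n by (auto simp: h_def W)
    ultimately have "(\<Sum>v\<in>h ` S. b v) \<le> k * 1" by (intro fractional) auto
    moreover have "inj_on h S" using S(1) by (intro inj_on_subset[OF h]) force
    ultimately have "(\<Sum>i\<in>S. b (h i)) \<le> k" by (simp add: sum.reindex)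
    then show ?thesis by (simp add: c_def h_def)
  qed
  have "(\<Sum>v\<in>W. b v) \<le> k * 2"
  proof (rule fractional)
    show "\<forall>e\<in>F. card (W \<inter> e) \<le> 2"
      using cycle_edge_card[OF cycle] cycle_Union[OF cycle] by (auto simp: Int_absorb1 Union_upper)
  qed simp
  then have total: "(\<Sum>i<n. c i) \<le> 2 * k"
    unfolding W using inj by (simp add: sum.reindex c_def mult.commute)
  obtain e where en: "e n \<le> e 0" and e: "\<And>i. i < n \<Longrightarrow> c i \<le> e i + e (Suc i)"
    and ek: "(\<Sum>i<n. e i) \<le> k"
    using cyclic_edge_cover[of n c k] stable total n by (auto simp: c_def)
  \<comment> \<open>The value \<open>e i\<close> belongs to the edge entering position \<open>i\<close>, hence the index shift; the
    edge entering position \<open>0\<close> gets \<open>e 0\<close>, which is at least \<open>e n\<close>.\<close>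
  obtain M where M: "set_mset M \<subseteq> F" "size M = (\<Sum>i<n. e (Suc i mod n))"
    and cnt: "\<And>i. i < n \<Longrightarrow> edge_count M (f (Suc i mod n)) = e (Suc i mod n) + e (Suc (Suc i mod n) mod n)"
    using cycle_weighting[OF _ inj F, of "\<lambda>i. e (Suc i mod n)"] n by auto
  have "size M = (\<Sum>i<n. e i)"
  proof -
    obtain m where m: "n = Suc m" using n by (cases n) auto
    have "(\<Sum>i<n. e (Suc i mod n)) = (\<Sum>i<m. e (Suc i)) + e 0" by (simp add: m)
    also have "\<dots> = (\<Sum>i<n. e i)" by (simp add: m sum.lessThan_Suc_shift add.commute del: sum.lessThan_Suc)
    finally show ?thesis using M by simp
  qed
  then have size: "size M \<le> k" using ek by simp
  have cover: "b v \<le> edge_count M v" if "v \<in> W" for v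
  proof -
    obtain j where j: "v = f j" "j < n" using \<open>v \<in> W\<close> W by auto
    obtain i where i: "i < n" "j = Suc i mod n"
    proof (cases j)
      case 0
      then show ?thesis using n by (intro that[of "n - 1"]) auto
    next
      case (Suc i)
      then show ?thesis using j by (intro that[of i]) auto
    qed
    have "e (Suc j) \<le> e (Suc j mod n)"
      using j(2) en by (cases "Suc j = n") auto
    then show ?thesis using cnt[OF i(1)] e[OF j(2)] j i(2) by (simp add: c_def)
  qed
  have "F \<noteq> {}" using F n by (auto simp: lessThan_empty_iff)
  then obtain e0 where "e0 \<in> F" by blast
  then show ?thesis
    using M(1) size cover
    by (intro exI[of _ "M + replicate_mset (k - size M) e0"]) (auto intro: trans_le_add1 split: if_splits)
qed

text \<open>
  Each edge of the cycle covers at most two of its \<open>n\<close> vertices, so at least \<open>n / 2\<close> edges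
  are needed, and \<open>n\<close> is odd.
\<close>
lemma odd_cycle_cover_size:
  assumes cycle: "cycle_graph n W F" and "odd n" and disj: "\<And>e. e \<in> F' \<Longrightarrow> e \<inter> W = {}"
    and M: "set_mset M \<subseteq> F \<union> F'" and cover: "\<And>v. v \<in> W \<Longrightarrow> edge_count M v > 0"
  shows "n + 1 \<le> 2 * size (filter_mset (\<lambda>e. e \<inter> W \<noteq> {}) M)"
proof -
  obtain f where "bij_betw f {..<n} W" using cycle by (auto simp: cycle_graph_def)
  then have W: "card W = n" "finite W"
    using bij_betw_same_card bij_betw_finite by fastforce+
  have "n = (\<Sum>v\<in>W. 1)" using W by simp
  also have "\<dots> \<le> (\<Sum>v\<in>W. edge_count M v)"
    using cover by (intro sum_mono) (simp add: Suc_le_eq)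
  also have "\<dots> = (\<Sum>e\<in>#M. card (W \<inter> e))" by (rule sum_edge_count[OF W(2)])
  also have "\<dots> \<le> 2 * size (filter_mset (\<lambda>e. e \<inter> W \<noteq> {}) M)"
    using M
  proof (induction M)
    case (add e M)
    have "card (W \<inter> e) \<le> (if e \<inter> W \<noteq> {} then 2 else 0)"
    proof (cases "e \<in> F")
      case True
      then have "e \<subseteq> W" using cycle_Union[OF cycle] by blast
      then have "W \<inter> e = e" by blast
      then show ?thesis using cycle_edge_card[OF cycle True] by (auto simp: Int_commute)
    next
      case False
      then have "e \<inter> W = {}" using disj add.prems by auto
      then show ?thesis by (simp add: Int_commute)
    qed
    then show ?case using add by (simp split: if_splits)
  qed simp
  finally show ?thesis using \<open>odd n\<close> by presburger
qed

text \<open>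
  The witness is the monomial with all exponents \<open>k - 1\<close>, where \<open>2 * k\<close> is the number of
  vertices. The \<open>2 * k\<close> edges are split arbitrarily into two halves \<open>A\<close> and \<open>B\<close> to
  write its square as a product of two elements of the \<open>k\<close>-th power.
\<close>
lemma two_odd_cycles_not_normal:
  fixes E :: "'v::finite set set"
  assumes gens: "\<And>C. minimal_vertex_cover E C \<longleftrightarrow> - C \<in> F1 \<union> F2"
    and c1: "cycle_graph m W1 F1" and "odd m" and c2: "cycle_graph n W2 F2" and "odd n"
    and W: "W1 \<inter> W2 = {}" "W1 \<union> W2 = UNIV"
  shows "\<not> normal_ideal (ideal_of_covers E :: ('v, 'k::comm_ring_1) mpoly set)"
proof
  let ?I = "ideal_of_covers E :: ('v, 'k) mpoly set"
  assume normal: "normal_ideal ?I"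
  obtain k where k: "m + n = 2 * k" using \<open>odd m\<close> \<open>odd n\<close> by (metis odd_even_add evenE)
  have mn: "m \<ge> 3" "n \<ge> 3" using c1 c2 by (auto simp: cycle_graph_def)
  have double: "\<exists>M. set_mset M \<subseteq> F \<and> size M = l \<and> (\<forall>v\<in>V. edge_count M v = 2)"
    if c: "cycle_graph l V F" for l V F
  proof -
    obtain f where f: "bij_betw f {..<l} V" and F: "F = (\<lambda>i. {f i, f (Suc i mod l)}) ` {..<l}"
      and l: "l \<ge> 3"
      using c by (auto simp: cycle_graph_def)
    obtain M where M: "set_mset M \<subseteq> F" "size M = l" "\<And>i. i < l \<Longrightarrow> edge_count M (f (Suc i mod l)) = 2"
      using cycle_weighting[OF _ _ F, of "\<lambda>_. 1"] l bij_betw_imp_inj_on[OF f] by auto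
    have "edge_count M v = 2" if "v \<in> V" for v
    proof -
      obtain j where j: "j < l" "v = f j" using f \<open>v \<in> V\<close> by (auto simp: bij_betw_def)
      have "Suc ((j + l - 1) mod l) mod l = j"
        using j(1) l by (simp add: mod_Suc_eq)
      then show ?thesis using M(3)[of "(j + l - 1) mod l"] j l by simp
    qed
    then show ?thesis using M by blast
  qed
  obtain M1 where M1: "set_mset M1 \<subseteq> F1" "size M1 = m" "\<forall>v\<in>W1. edge_count M1 v = 2"
    using double[OF c1] by blast
  obtain M2 where M2: "set_mset M2 \<subseteq> F2" "size M2 = n" "\<forall>v\<in>W2. edge_count M2 v = 2"
    using double[OF c2] by blast
  have out: "edge_count M v = 0" if "set_mset M \<subseteq> F" "v \<notin> \<Union> F" for M :: "'v set multiset" and F v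
    using that edge_count_pos[of M v] by auto
  define M where "M = M1 + M2"
  have M: "set_mset M \<subseteq> F1 \<union> F2" "size M = 2 * k" using M1 M2 k by (auto simp: M_def)
  have M_two: "edge_count M v = 2" for v
  proof (cases "v \<in> W1")
    case True
    then have "v \<notin> W2" using W by blast
    then show ?thesis
      using True M1(3) out[OF M2(1), of v] cycle_Union[OF c2] by (simp add: M_def)
  next
    case False
    then have "v \<in> W2" using W by blast
    then show ?thesis
      using False M2(3) out[OF M1(1), of v] cycle_Union[OF c1] by (simp add: M_def)
  qed
  obtain A where A: "A \<subseteq># M" "size A = k"
  proof -
    obtain xs where xs: "mset xs = M" using ex_mset by blast
    have "mset (take k xs) + mset (drop k xs) = M" using xs by (simp flip: mset_append)
    then have "mset (take k xs) \<subseteq># M" by (metis mset_subset_eq_add_left)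
    moreover have "size (mset (take k xs)) = k" using xs M(2) size_mset[of xs] by simp
    ultimately show ?thesis using that by blast
  qed
  define B where "B = M - A"
  have AB: "A + B = M" using A by (simp add: B_def)
  have B: "size B = k" using AB A(2) M(2) by (metis add_left_cancel mult_2 size_union)
  define u where "u N = exponent (\<lambda>v. k - edge_count N v)" for N :: "'v set multiset"
  define a where "a = exponent (\<lambda>_::'v. k - 1)"
  have "(Poly_Mapping.single (u N) 1 :: ('v, 'k) mpoly) \<in> ideal_power ?I k"
    if "N = A \<or> N = B" for N
  proof -
    have "set_mset N \<subseteq> F1 \<union> F2" "size N = k" using that AB M A(2) B by auto
    moreover have "size N \<le> Poly_Mapping.lookup (u N) v + edge_count N v" for v
      using \<open>size N = k\<close> by (simp add: u_def)
    ultimately show ?thesis using monomial_mem_cover_power[OF gens, of N "u N"] by simp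
  qed
  then have "(Poly_Mapping.single (u A) 1 * (Poly_Mapping.single (u B) 1 * 1) :: ('v, 'k) mpoly)
      \<in> ideal_power (ideal_power ?I k) 2"
    unfolding numeral_2_eq_2 ideal_power.simps by (intro ideal_mult_times) auto
  moreover have "u A + u B = a + a"
  proof (rule poly_mapping_eqI)
    fix v
    have "edge_count A v + edge_count B v = 2" using M_two[of v] by (simp flip: AB)
    moreover have "edge_count A v \<le> k" "edge_count B v \<le> k"
      using edge_count_le_size[of A v] edge_count_le_size[of B v] A(2) B by auto
    ultimately show "Poly_Mapping.lookup (u A + u B) v = Poly_Mapping.lookup (a + a) v"
      using k mn by (simp add: lookup_add u_def a_def)
  qed
  ultimately have "(Poly_Mapping.single a 1 * Poly_Mapping.single a 1 :: ('v, 'k) mpoly)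
      \<in> ideal_power (ideal_power ?I k) 2"
    by (simp add: mult_single)
  then have "(Poly_Mapping.single a 1 :: ('v, 'k) mpoly) \<in> integral_closure (ideal_power ?I k)"
    by (rule square_root_in_integral_closure)
  moreover have "k \<ge> 1" using k mn by simp
  ultimately have "(Poly_Mapping.single a 1 :: ('v, 'k) mpoly) \<in> ideal_power ?I k"
    using normal unfolding normal_ideal_def by blast
  then have "a \<in> power_exponents (F1 \<union> F2) k"
    unfolding ideal_power_of_covers[OF gens] by (simp add: supported_on_def)
  then obtain N where N: "set_mset N \<subseteq> F1 \<union> F2" "size N = k"
    and cov: "\<And>v. k \<le> k - 1 + edge_count N v"
    by (auto simp: power_exponents_def a_def)
  have pos: "edge_count N v > 0" for v using cov[of v] \<open>k \<ge> 1\<close> by linarith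
  have d1: "e \<inter> W2 = {}" if "e \<in> F1" for e using that W(1) cycle_Union[OF c1] by blast
  have d2: "e \<inter> W1 = {}" if "e \<in> F2" for e using that W(1) cycle_Union[OF c2] by blast
  have "m + 1 \<le> 2 * size (filter_mset (\<lambda>e. e \<inter> W1 \<noteq> {}) N)"
    using odd_cycle_cover_size[OF c1 \<open>odd m\<close> d2 N(1)] pos by blast
  moreover have "n + 1 \<le> 2 * size (filter_mset (\<lambda>e. e \<inter> W2 \<noteq> {}) N)"
    using odd_cycle_cover_size[OF c2 \<open>odd n\<close> d1 _] N(1) pos by (simp add: Un_commute)
  moreover have "size (filter_mset (\<lambda>e. e \<inter> W1 \<noteq> {}) N) + size (filter_mset (\<lambda>e. e \<inter> W2 \<noteq> {}) N) \<le> size N"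
    using N(1) d1 d2 by (induction N) auto
  ultimately show False using N(2) k by linarith
qed

lemma triangle_free_disjoint_Un:
  assumes "triangle_free F1" "triangle_free F2" "\<Union> F1 \<inter> \<Union> F2 = {}"
  shows "triangle_free (F1 \<union> F2)"
proof -
  have "{x, y} \<in> F2 \<Longrightarrow> {y, z} \<notin> F1" "{x, y} \<in> F2 \<Longrightarrow> {x, z} \<notin> F1"
    "{x, y} \<in> F1 \<Longrightarrow> {y, z} \<notin> F2" "{x, y} \<in> F1 \<Longrightarrow> {x, z} \<notin> F2" for x y z
    using assms(3) by blast+
  then show ?thesis using assms(1,2) unfolding triangle_free_def Un_iff by meson
qed

theorem corollary5p9:
  fixes E :: "'v::finite set set"
  assumes "simple_graph E"
  shows "((\<exists>W1 W2 F1 F2 m n.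
             odd m \<and> m \<ge> 5 \<and> cycle_graph m W1 F1 \<and>
             odd n \<and> n \<ge> 5 \<and> cycle_graph n W2 F2 \<and>
             W1 \<inter> W2 = {} \<and> W1 \<union> W2 = UNIV \<and> complement_graph E = F1 \<union> F2) \<longrightarrow>
           \<not> normal_ideal (ideal_of_covers E :: ('v, 'k::field) mpoly set)) \<and>
         ((\<exists>n. odd n \<and> n \<ge> 5 \<and> cycle_graph n UNIV (complement_graph E)) \<longrightarrow>
           normal_ideal (ideal_of_covers E :: ('v, 'k) mpoly set))"
proof (intro conjI impI)
  assume "\<exists>W1 W2 F1 F2 m n.
             odd m \<and> m \<ge> 5 \<and> cycle_graph m W1 F1 \<and>
             odd n \<and> n \<ge> 5 \<and> cycle_graph n W2 F2 \<and>
             W1 \<inter> W2 = {} \<and> W1 \<union> W2 = UNIV \<and> complement_graph E = F1 \<union> F2"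
  then obtain W1 W2 F1 F2 m n where m: "odd m" "m \<ge> 5" and c1: "cycle_graph m W1 F1"
    and n: "odd n" "n \<ge> 5" and c2: "cycle_graph n W2 F2"
    and W: "W1 \<inter> W2 = {}" "W1 \<union> W2 = UNIV" and F: "complement_graph E = F1 \<union> F2"
    by blast
  have "triangle_free F1" "triangle_free F2"
    using cycle_triangle_free[OF c1] cycle_triangle_free[OF c2] m n by auto
  then have "triangle_free (complement_graph E)"
    unfolding F using W(1) cycle_Union[OF c1] cycle_Union[OF c2]
    by (intro triangle_free_disjoint_Un) auto
  moreover have "\<Union> (complement_graph E) = UNIV"
    unfolding F using W(2) cycle_Union[OF c1] cycle_Union[OF c2] by simp
  ultimately have "minimal_vertex_cover E C \<longleftrightarrow> - C \<in> F1 \<union> F2" for C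
    using minimal_vertex_cover_iff_complement_edge[OF assms] F by simp
  then show "\<not> normal_ideal (ideal_of_covers E :: ('v, 'k) mpoly set)"
    using two_odd_cycles_not_normal c1 m(1) c2 n(1) W by metis
next
  assume "\<exists>n. odd n \<and> n \<ge> 5 \<and> cycle_graph n UNIV (complement_graph E)"
  then obtain n where n: "n \<ge> 5" and c: "cycle_graph n UNIV (complement_graph E)" by blast
  have "minimal_vertex_cover E C \<longleftrightarrow> - C \<in> complement_graph E" for C
    using minimal_vertex_cover_iff_complement_edge[OF assms] cycle_triangle_free[OF c]
      cycle_Union[OF c] n by simp
  then show "normal_ideal (ideal_of_covers E :: ('v, 'k) mpoly set)"
    by (rule normal_ideal_of_coversI) (use cycle_rounding[OF c] in auto)
qed

end
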